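(* Let $\Gamma=\{a(t):t\in[t_{\min},t_{\max}]\}$ be the trajectory of a moving point source with $a\in C^1([t_{\min},t_{\max}];\mathbb R^d)$. (i) The $\Theta$-convex domain of $\Gamma$ associated with all observable directions $\hat x\in\mathbb S^{d-1}$ is uniquely determined by the multi-frequency data $\{w^\infty(\hat x,k):\hat x\in\mathbb S^{d-1},\ k\in(k_{\min},k_{\max})\}$. (ii) Let $\hat x\in\mathbb S^{d-1}$ be an arbitrarily fixed observable direction. Then the strip $K_\Gamma^{(\hat x)}$ is uniquely determined by the multi-frequency data $\{w^\infty(\hat x,k):k\in(k_{\min},k_{\max})\}$. In particular, the strip $\{y\in\mathbb R^d:\hat x\cdot y\in\hat x\cdot\Gamma\}$ is uniquely determined by these data if $1+\hat x\cdot a'(t)>0$ for all $t\in[t_{\min},t_{\max}]$.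
   Context: Let $d\in\{2,3\}$, and let $0<t_{\min}<t_{\max}$ (starting and terminal times, both known) and $0<k_{\min}<k_{\max}$ be given; put $T=t_{\max}-t_{\min}$. For an orbit function $a\in C^1([t_{\min},t_{\max}];\mathbb R^d)$, $\hat x\in\mathbb S^{d-1}$ and $k\in\mathbb R$, the far-field pattern is $$w^\infty(\hat x,k)=\frac1{\sqrt{2\pi}}\int_{t_{\min}}^{t_{\max}}e^{-ik(\hat x\cdot a(t)+t)}\,dt .$$ Put $h(t)=\hat x\cdot a(t)+t$, $\xi_{\min}^{(\hat x)}=\inf_{[t_{\min},t_{\max}]}h$, $\xi_{\max}^{(\hat x)}=\sup_{[t_{\min},t_{\max}]}h$. The direction $\hat x$ is called observable (for $a$) if $\xi_{\max}^{(\hat x)}-\xi_{\min}^{(\hat x)}\ge T$. For observable $\hat x$, $$K_\Gamma^{(\hat x)}=\{y\in\mathbb R^d:\ \xi_{\min}^{(\hat x)}-t_{\min}\le\hat x\cdot y\le\xi_{\max}^{(\hat x)}-t_{\max}\}.$$ The $\Theta$-convex domain of $\Gamma$ associated with a set of observable directions is the intersection of the strips $K_\Gamma^{(\hat x)}$ over the directions $\hat x$ in this set. Also $\hat x\cdot\Gamma=\{\hat x\cdot y:y\in\Gamma\}\subset\mathbb R$. "Uniquely determined by the data" means: whenever two orbit functions in $C^1([t_{\min},t_{\max}];\mathbb R^d)$ (with the same known $t_{\min},t_{\max}$), both satisfying the hypotheses of the respective assertion (no further hypothesis in (i); $\hat x$ observable for both in (ii); and additionally the stated positivity condition for both in the last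 sentence), generate the same data, the corresponding sets coincide. *)

theory Defs
  imports "HOL-Analysis.Analysis"
begin

text \<open>Orbit functions are total functions of which only the restriction to
  \<open>[tmin, tmax]\<close> matters. Differentiability is therefore taken within the interval, so it is
  one-sided at the end points (unlike \<open>C1_differentiable_on\<close>, which would constrain
  values outside the interval).\<close>

definition C1_orbit :: "real \<Rightarrow> real \<Rightarrow> (real \<Rightarrow> 'a::euclidean_space) \<Rightarrow> bool" where
  "C1_orbit tmin tmax a \<longleftrightarrow>
     (\<exists>a'. (\<forall>t\<in>{tmin..tmax}. (a has_vector_derivative a' t) (at t within {tmin..tmax})) \<and>
           continuous_on {tmin..tmax} a')"

definition trajectory :: "real \<Rightarrow> real \<Rightarrow> (real \<Rightarrow> 'a::euclidean_space) \<Rightarrow> 'a set" where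
  "trajectory tmin tmax a = a ` {tmin..tmax}"

definition far_field ::
  "real \<Rightarrow> real \<Rightarrow> (real \<Rightarrow> 'a::euclidean_space) \<Rightarrow> 'a \<Rightarrow> real \<Rightarrow> complex" where
  "far_field tmin tmax a x k =
     1 / complex_of_real (sqrt (2 * pi)) *
     integral {tmin..tmax} (\<lambda>t. exp (- (\<i> * complex_of_real k * complex_of_real (x \<bullet> a t + t))))"

definition phase :: "(real \<Rightarrow> 'a::euclidean_space) \<Rightarrow> 'a \<Rightarrow> real \<Rightarrow> real" where
  "phase a x t = x \<bullet> a t + t"

definition xi_min :: "real \<Rightarrow> real \<Rightarrow> (real \<Rightarrow> 'a::euclidean_space) \<Rightarrow> 'a \<Rightarrow> real" where
  "xi_min tmin tmax a x = (INF t\<in>{tmin..tmax}. phase a x t)"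

definition xi_max :: "real \<Rightarrow> real \<Rightarrow> (real \<Rightarrow> 'a::euclidean_space) \<Rightarrow> 'a \<Rightarrow> real" where
  "xi_max tmin tmax a x = (SUP t\<in>{tmin..tmax}. phase a x t)"

definition observable :: "real \<Rightarrow> real \<Rightarrow> (real \<Rightarrow> 'a::euclidean_space) \<Rightarrow> 'a \<Rightarrow> bool" where
  "observable tmin tmax a x \<longleftrightarrow> xi_max tmin tmax a x - xi_min tmin tmax a x \<ge> tmax - tmin"

definition strip_K :: "real \<Rightarrow> real \<Rightarrow> (real \<Rightarrow> 'a::euclidean_space) \<Rightarrow> 'a \<Rightarrow> 'a set" where
  "strip_K tmin tmax a x =
     {y. xi_min tmin tmax a x - tmin \<le> x \<bullet> y \<and> x \<bullet> y \<le> xi_max tmin tmax a x - tmax}"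

text \<open>The set \<open>D\<close> is meant to consist of observable directions; for empty \<open>D\<close> the
  intersection is the whole space.\<close>

definition Theta_convex_domain ::
  "real \<Rightarrow> real \<Rightarrow> (real \<Rightarrow> 'a::euclidean_space) \<Rightarrow> 'a set \<Rightarrow> 'a set" where
  "Theta_convex_domain tmin tmax a D = (\<Inter>x\<in>D. strip_K tmin tmax a x)"

definition observable_directions ::
  "real \<Rightarrow> real \<Rightarrow> (real \<Rightarrow> 'a::euclidean_space) \<Rightarrow> 'a set" where
  "observable_directions tmin tmax a = {x \<in> sphere 0 1. observable tmin tmax a x}"

definition trajectory_strip ::
  "real \<Rightarrow> real \<Rightarrow> (real \<Rightarrow> 'a::euclidean_space) \<Rightarrow> 'a \<Rightarrow> 'a set" where
  "trajectory_strip tmin tmax a x = {y. x \<bullet> y \<in> (\<lambda>z. x \<bullet> z) ` trajectory tmin tmax a}"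

end

theory Submission
  imports Defs
begin

text \<open>Differentiating the data \<open>n\<close> times at a single frequency \<open>k\<close> determines
  \<open>\<integral> h\<^sup>n e\<^bsup>-ikh\<^esup> dt\<close> for every \<open>n\<close>, hence, by the Weierstrass theorem,
  \<open>\<integral> u(h(t)) dt\<close> for every continuous \<open>u\<close>: the data determine the distribution of
  the phase \<open>h\<close>, and no analytic continuation in \<open>k\<close> is needed. The range of
  \<open>h\<close> is the support of this distribution, which gives the strips, and an increasing \<open>h\<close>
  is the quantile function of its distribution, which gives \<open>x \<bullet> a = h - id\<close>.\<close>

section \<open>Pointwise equality from equal integrals\<close>

text \<open>The difference \<open>g - f\<close> is continuous, nonnegative and has integral zero, so
  it vanishes. This turns integral identities for well-chosen test functions into pointwise
  information.\<close>

lemma eq_of_continuous_le_integral_eq: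
  fixes f g :: "real \<Rightarrow> real"
  assumes "p < q" and f: "continuous_on {p..q} f" and g: "continuous_on {p..q} g"
    and le: "\<And>t. t \<in> {p..q} \<Longrightarrow> f t \<le> g t"
    and eq: "integral {p..q} f = integral {p..q} g"
    and t: "t \<in> {p..q}"
  shows "f t = g t"
proof -
  have "integral {p..q} (\<lambda>t. g t - f t) = 0"
    using eq by (simp add: integral_diff integrable_continuous_interval f g)
  then have "\<forall>t\<in>{p..q}. g t - f t = 0"
    by (subst (asm) integral_eq_0_iff) (use assms in \<open>auto intro!: continuous_intros\<close>)
  then show ?thesis using t by simp
qed

section \<open>From data on a frequency interval to integrals of functions of the phase\<close>

text \<open>Differentiation under the integral sign: each derivative in \<open>k\<close> brings down
  a factor \<open>-i * h t\<close> and so raises the moment by one.\<close>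

lemma phase_moment_has_vector_derivative:
  fixes h :: "real \<Rightarrow> real"
  assumes h: "continuous_on {p..q} h"
  shows "((\<lambda>k. integral {p..q} (\<lambda>t. complex_of_real (h t ^ n) * cis (- (k * h t))))
    has_vector_derivative
      - \<i> * integral {p..q} (\<lambda>t. complex_of_real (h t ^ Suc n) * cis (- (k * h t)))) (at k)"
proof -
  let ?f = "\<lambda>k t. complex_of_real (h t ^ n) * cis (- (k * h t))"
  let ?f' = "\<lambda>k t. - \<i> * (complex_of_real (h t ^ Suc n) * cis (- (k * h t)))"
  have h': "continuous_on (UNIV \<times> cbox p q) (\<lambda>z. h (snd z))"
    by (rule continuous_on_compose2[OF h]) (auto intro!: continuous_intros)
  have "((\<lambda>k. integral (cbox p q) (?f k)) has_vector_derivative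
      integral (cbox p q) (?f' k)) (at k within UNIV)"
  proof (rule leibniz_rule_vector_derivative)
    fix k t
    \<comment> \<open>The frequency is first made a complex variable \<open>z\<close>, so that the
      field derivative rules apply, and then restricted to the real line.\<close>
    have "((\<lambda>z. complex_of_real (h t ^ n) * exp (\<i> * (- (z * complex_of_real (h t)))))
        has_field_derivative ?f' k t) (at (complex_of_real k))"
      unfolding cis_conv_exp by (auto intro!: derivative_eq_intros simp: algebra_simps)
    from has_vector_derivative_real_field[OF this]
    show "((\<lambda>k. ?f k t) has_vector_derivative ?f' k t) (at k within UNIV)"
      by (simp add: cis_conv_exp)
  next
    fix k
    show "?f k integrable_on cbox p q"
      using h by (auto intro!: integrable_continuous_interval continuous_intros simp: cis_conv_exp)
  next
    show "continuous_on (UNIV \<times> cbox p q) (\<lambda>(k, t). ?f' k t)"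
      unfolding case_prod_unfold cis_conv_exp
      by (intro continuous_intros h')
  qed auto
  then show ?thesis by simp
qed

text \<open>Induction on \<open>n\<close>. Moments of order \<open>n\<close> that agree on an open
  interval have equal derivatives there, and these are the next moments up to the factor
  \<open>-i\<close>. Hence \<open>k\<close> must vary in the induction hypothesis.\<close>

lemma phase_moments_eq:
  fixes g h :: "real \<Rightarrow> real"
  assumes g: "continuous_on {p..q} g" and h: "continuous_on {p..q} h"
    and eq: "\<And>k. k \<in> {c<..<d} \<Longrightarrow>
      integral {p..q} (\<lambda>t. cis (- (k * g t))) = integral {p..q} (\<lambda>t. cis (- (k * h t)))"
    and k: "k \<in> {c<..<d}"
  shows "integral {p..q} (\<lambda>t. complex_of_real (g t ^ n) * cis (- (k * g t))) =
    integral {p..q} (\<lambda>t. complex_of_real (h t ^ n) * cis (- (k * h t)))"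
  using k
proof (induction n arbitrary: k)
  case 0
  then show ?case using eq by simp
next
  case (Suc n)
  let ?J = "\<lambda>f n k. integral {p..q} (\<lambda>t. complex_of_real (f t ^ n) * cis (- (k * f t)))"
  \<comment> \<open>The derivative of the moment of \<open>g\<close> carries over to that of
    \<open>h\<close>, since both moments agree near \<open>k\<close>; uniqueness of derivatives then
    finishes the step.\<close>
  have "(?J h n has_vector_derivative - \<i> * ?J g (Suc n) k) (at k)"
    by (rule has_vector_derivative_transform_within_open
        [OF phase_moment_has_vector_derivative[OF g] _ Suc.prems Suc.IH]) auto
  from vector_derivative_unique_at[OF this phase_moment_has_vector_derivative[OF h]]
  show ?case by simp
qed

text \<open>By linearity the equal moments settle polynomial weights; a continuous weight is a
  uniform limit of these on a compact set. The factor \<open>cis\<close> has modulus 1 and does not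
  enlarge the error.\<close>

lemma phase_weighted_integral_eq:
  fixes g h u :: "real \<Rightarrow> real"
  assumes g: "continuous_on {p..q} g" and h: "continuous_on {p..q} h"
    and eq: "\<And>n. integral {p..q} (\<lambda>t. complex_of_real (g t ^ n) * cis (- (k * g t))) =
      integral {p..q} (\<lambda>t. complex_of_real (h t ^ n) * cis (- (k * h t)))"
    and u: "continuous_on UNIV u"
  shows "integral {p..q} (\<lambda>t. complex_of_real (u (g t)) * cis (- (k * g t))) =
    integral {p..q} (\<lambda>t. complex_of_real (u (h t)) * cis (- (k * h t)))"
proof (cases "p \<le> q")
  case pq: True
  let ?I = "\<lambda>u f. integral {p..q} (\<lambda>t. complex_of_real (u (f t)) * cis (- (k * f t)))"
  \<comment> \<open>A compact set containing both ranges, so that one polynomial \<open>w\<close>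
    serves for \<open>g\<close> and \<open>h\<close> at once.\<close>
  define S where "S = g ` {p..q} \<union> h ` {p..q}"
  have S: "compact S"
    unfolding S_def by (intro compact_Un compact_continuous_image g h) auto
  have int: "(\<lambda>t. complex_of_real (w (f t)) * cis (- (k * f t))) integrable_on {p..q}"
    if "continuous_on UNIV w" "continuous_on {p..q} f" for w f :: "real \<Rightarrow> real"
    unfolding cis_conv_exp
    by (intro integrable_continuous_interval continuous_intros that
        continuous_on_compose2[OF that(1) that(2)]) auto
  have bound: "norm (?I u g - ?I u h) \<le> e * (2 * (q - p))" if e: "e > 0" for e
  proof -
    obtain w where w: "real_polynomial_function w" "\<And>y. y \<in> S \<Longrightarrow> \<bar>u y - w y\<bar> < e"
      using Stone_Weierstrass_real_polynomial_function[OF S continuous_on_subset[OF u] e] by auto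
    then obtain c N where wsum: "w = (\<lambda>y. \<Sum>i\<le>N. c i * y ^ i)"
      by (auto simp: real_polynomial_function_iff_sum)
    have wc: "continuous_on UNIV w"
      unfolding wsum by (intro continuous_intros)
    have I_w: "?I w f = (\<Sum>i\<le>N. complex_of_real (c i) * ?I (\<lambda>y. y ^ i) f)"
      if "continuous_on {p..q} f" for f
    proof -
      have "?I w f = integral {p..q} (\<lambda>t. \<Sum>i\<le>N. complex_of_real (c i) *
          (complex_of_real (f t ^ i) * cis (- (k * f t))))"
        unfolding wsum by (simp add: sum_distrib_right mult.assoc)
      also have "\<dots> = (\<Sum>i\<le>N. complex_of_real (c i) * ?I (\<lambda>y. y ^ i) f)"
        by (subst integral_sum)
          (auto intro!: integrable_on_mult_right int that continuous_intros simp del: of_real_power)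
      finally show ?thesis .
    qed
    have ww: "?I w g = ?I w h"
      using I_w[OF g] I_w[OF h] eq by simp
    have bd: "norm (?I u f - ?I w f) \<le> e * (q - p)"
      if f: "continuous_on {p..q} f" "f ` {p..q} \<subseteq> S" for f
    proof -
      have "?I u f - ?I w f =
          integral {p..q} (\<lambda>t. complex_of_real (u (f t)) * cis (- (k * f t))
            - complex_of_real (w (f t)) * cis (- (k * f t)))"
        by (rule integral_diff[symmetric]; rule int[OF _ f(1)]; fact u wc)
      also have "norm \<dots> \<le> integral {p..q} (\<lambda>t. e)"
      proof (rule integral_norm_bound_integral)
        fix t assume "t \<in> {p..q}"
        then have "f t \<in> S" using f by blast
        then have "\<bar>u (f t) - w (f t)\<bar> < e" by (rule w)
        then show "norm (complex_of_real (u (f t)) * cis (- (k * f t))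
            - complex_of_real (w (f t)) * cis (- (k * f t))) \<le> e"
          by (simp add: norm_mult flip: left_diff_distrib of_real_diff)
      qed (auto intro!: integrable_diff int u wc f)
      finally show ?thesis using pq by (simp add: mult.commute)
    qed
    have "norm (?I u g - ?I u h) \<le> norm (?I u g - ?I w g) + norm (?I u h - ?I w h)"
      using norm_triangle_ineq4[of "?I u g - ?I w g" "?I u h - ?I w h"] ww by simp
    also have "\<dots> \<le> e * (q - p) + e * (q - p)"
      by (intro add_mono bd g h) (auto simp: S_def)
    finally show ?thesis by (simp add: algebra_simps)
  qed
  have "norm (?I u g - ?I u h) \<le> e" if e: "e > 0" for e
  proof -
    \<comment> \<open>The summand 1 keeps the denominator positive when
      \<open>p = q\<close>.\<close>
    define e' where "e' = e / (2 * (q - p) + 1)"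
    have "e' > 0" using e pq by (simp add: e'_def)
    then have "norm (?I u g - ?I u h) \<le> e' * (2 * (q - p))" by (rule bound)
    also have "\<dots> \<le> e' * (2 * (q - p) + 1)" using \<open>e' > 0\<close> by simp
    also have "\<dots> = e" using pq by (simp add: e'_def)
    finally show ?thesis .
  qed
  then have "norm (?I u g - ?I u h) \<le> 0"
    by (rule field_le_epsilon[of _ 0, simplified])
  then show ?thesis by simp
\<comment> \<open>For \<open>q < p\<close> the interval is empty and both integrals are 0.\<close>
qed auto

text \<open>The oscillating factor is removed by absorbing its inverse \<open>cis (k * y)\<close>
  into the weight. As weights are real, this is done through the real and imaginary parts
  \<open>?C\<close> and \<open>?S\<close>.\<close>

lemma integral_compose_phase_eq:
  fixes g h u :: "real \<Rightarrow> real"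
  assumes g: "continuous_on {p..q} g" and h: "continuous_on {p..q} h"
    and cd: "c < d"
    and eq: "\<And>k. k \<in> {c<..<d} \<Longrightarrow>
      integral {p..q} (\<lambda>t. cis (- (k * g t))) = integral {p..q} (\<lambda>t. cis (- (k * h t)))"
    and u: "continuous_on UNIV u"
  shows "integral {p..q} (\<lambda>t. u (g t)) = integral {p..q} (\<lambda>t. u (h t))"
proof -
  obtain k where k: "k \<in> {c<..<d}"
    using dense[OF cd] by auto
  let ?C = "\<lambda>y. u y * cos (k * y)" and ?S = "\<lambda>y. u y * sin (k * y)"
  let ?I = "\<lambda>u f. integral {p..q} (\<lambda>t. complex_of_real (u (f t)) * cis (- (k * f t)))"
  have cont: "continuous_on UNIV ?C" "continuous_on UNIV ?S"
    by (intro continuous_intros u)+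
  have split: "complex_of_real (integral {p..q} (\<lambda>t. u (f t))) = ?I ?C f + \<i> * ?I ?S f"
    if f: "continuous_on {p..q} f" for f
  proof -
    have int: "(\<lambda>t. complex_of_real (w (f t)) * cis (- (k * f t))) integrable_on {p..q}"
      if "continuous_on UNIV w" for w :: "real \<Rightarrow> real"
      unfolding cis_conv_exp
      by (intro integrable_continuous_interval continuous_intros f
          continuous_on_compose2[OF that f]) auto
    have uf: "(\<lambda>t. u (f t)) integrable_on {p..q}"
      by (intro integrable_continuous_interval continuous_on_compose2[OF u f]) auto
    have pt: "complex_of_real (u y) = complex_of_real (?C y) * cis (- (k * y))
        + \<i> * (complex_of_real (?S y) * cis (- (k * y)))" for y
    proof -
      have "complex_of_real (u y) = complex_of_real (u y) * (cis (k * y) * cis (- (k * y)))"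
        by (simp add: cis_mult)
      also have "cis (k * y) = complex_of_real (cos (k * y)) + \<i> * complex_of_real (sin (k * y))"
        by (simp add: complex_eq_iff)
      finally show ?thesis by (simp add: algebra_simps)
    qed
    have "complex_of_real (integral {p..q} (\<lambda>t. u (f t))) =
        integral {p..q} (\<lambda>t. complex_of_real (u (f t)))"
      using integral_linear[OF uf bounded_linear_of_real[where 'a = complex]] by (simp add: o_def)
    also have "\<dots> = integral {p..q} (\<lambda>t. complex_of_real (?C (f t)) * cis (- (k * f t))
        + \<i> * (complex_of_real (?S (f t)) * cis (- (k * f t))))"
      by (simp only: pt[symmetric])
    also have "\<dots> = ?I ?C f + integral {p..q} (\<lambda>t. \<i> * (complex_of_real (?S (f t)) * cis (- (k * f t))))"
      by (rule integral_add[OF int[OF cont(1)] integrable_on_mult_right[OF int[OF cont(2)]]])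
    finally show ?thesis by simp
  qed
  have I: "?I w g = ?I w h" if "continuous_on UNIV w" for w
    by (rule phase_weighted_integral_eq[OF g h phase_moments_eq[OF g h eq k] that])
  have "complex_of_real (integral {p..q} (\<lambda>t. u (g t))) =
      complex_of_real (integral {p..q} (\<lambda>t. u (h t)))"
    unfolding split[OF g] split[OF h] I[OF cont(1)] I[OF cont(2)] ..
  then show ?thesis
    by (simp only: of_real_eq_iff)
qed

section \<open>Continuous functions with the same distribution\<close>

text \<open>\<open>integral_eq\<close> says that \<open>g\<close> and \<open>h\<close> push Lebesgue
  measure on \<open>{p..q}\<close> forward to the same measure, expressed by continuous test
  functions to stay within elementary integration.\<close>

locale equidistributed =
  fixes p q :: real and g h :: "real \<Rightarrow> real"
  assumes pq: "p < q"
    and cont_g: "continuous_on {p..q} g" and cont_h: "continuous_on {p..q} h"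
    and integral_eq: "\<And>u. continuous_on UNIV u \<Longrightarrow>
      integral {p..q} (\<lambda>t. u (g t)) = integral {p..q} (\<lambda>t. u (h t :: real) :: real)"
begin

lemma swap: "equidistributed p q h g"
  using pq cont_g cont_h integral_eq by unfold_locales auto

text \<open>The test function is the distance to the range of \<open>h\<close>. It vanishes along
  \<open>h\<close>, so its integral along \<open>g\<close> is zero and it vanishes along
  \<open>g\<close> too.\<close>

lemma image_subset: "g ` {p..q} \<subseteq> h ` {p..q}"
proof
  fix y assume "y \<in> g ` {p..q}"
  then obtain t where t: "t \<in> {p..q}" and y: "y = g t" by auto
  let ?u = "\<lambda>y. infdist y (h ` {p..q})"
  have u: "continuous_on UNIV ?u"
    by (intro continuous_intros)
  \<comment> \<open>Closedness turns distance zero into membership; nonemptiness excludes the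
    convention that \<open>infdist\<close> to the empty set is 0.\<close>
  have ne: "h ` {p..q} \<noteq> {}" and cl: "closed (h ` {p..q})"
    using pq compact_continuous_image[OF cont_h] by (auto intro: compact_imp_closed)
  have "?u (h s) = ?u (g s)" if "s \<in> {p..q}" for s
  proof (rule eq_of_continuous_le_integral_eq[OF pq _ _ _ _ that])
    show "continuous_on {p..q} (\<lambda>s. ?u (h s))" "continuous_on {p..q} (\<lambda>s. ?u (g s))"
      by (intro continuous_intros cont_g cont_h)+
    show "integral {p..q} (\<lambda>s. ?u (h s)) = integral {p..q} (\<lambda>s. ?u (g s))"
      using integral_eq[OF u] by simp
  qed (auto simp: infdist_nonneg)
  then have "?u y = 0" using t y by (metis imageI infdist_zero)
  then show "y \<in> h ` {p..q}"
    using in_closed_iff_infdist_zero[OF cl ne] by simp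
qed

text \<open>If \<open>g t < h t\<close>, a cut-off which is 1 below \<open>g t\<close> and 0 above \<open>h t\<close>
  satisfies \<open>u \<circ> h \<le> indicator {..t} \<le> u \<circ> g\<close>, with strict inequality at \<open>t\<close>.\<close>
lemma mono_le:
  assumes g: "mono_on {p..q} g" and h: "mono_on {p..q} h" and t: "t \<in> {p..q}"
  shows "h t \<le> g t"
proof (rule ccontr)
  assume "\<not> h t \<le> g t"
  then have lt: "g t < h t" by simp
  define u where "u y = min 1 (max 0 ((h t - y) / (h t - g t)))" for y
  have u: "continuous_on UNIV u"
    unfolding u_def using lt by (intro continuous_intros) auto
  have u_range: "0 \<le> u y" "u y \<le> 1" for y
    by (auto simp: u_def)
  have u_1: "u y = 1" if "y \<le> g t" for y
    using that lt by (simp add: u_def)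
  have u_0: "u y = 0" if "h t \<le> y" for y
    using that lt by (simp add: u_def divide_nonpos_pos)
  have "u (h t) = u (g t)"
  proof (rule eq_of_continuous_le_integral_eq[OF pq _ _ _ _ t])
    show "continuous_on {p..q} (\<lambda>s. u (h s))"
      by (rule continuous_on_compose2[OF u cont_h]) simp
    show "continuous_on {p..q} (\<lambda>s. u (g s))"
      by (rule continuous_on_compose2[OF u cont_g]) simp
    show "integral {p..q} (\<lambda>s. u (h s)) = integral {p..q} (\<lambda>s. u (g s))"
      using integral_eq[OF u] by simp
    fix s assume s: "s \<in> {p..q}"
    show "u (h s) \<le> u (g s)"
    proof (cases "s \<le> t")
      case True
      then show ?thesis using u_1 u_range mono_onD[OF g s t] by metis
    next
      case False
      then show ?thesis using u_0 u_range mono_onD[OF h t s] by (metis linear)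
    qed
  qed
  then show False using u_0 u_1 by simp
qed

end

lemma (in equidistributed) image_eq: "g ` {p..q} = h ` {p..q}"
  using image_subset equidistributed.image_subset[OF swap] by blast

lemma (in equidistributed) mono_eq:
  assumes "mono_on {p..q} g" "mono_on {p..q} h" "t \<in> {p..q}"
  shows "g t = h t"
  using mono_le[OF assms] equidistributed.mono_le[OF swap assms(2,1,3)] by simp

section \<open>Phases of orbits with the same far-field data\<close>

lemma C1_orbit_continuous_on: "C1_orbit p q a \<Longrightarrow> continuous_on {p..q} a"
  unfolding C1_orbit_def
  by (metis has_vector_derivative_continuous continuous_on_eq_continuous_within)

lemma continuous_on_phase: "C1_orbit p q a \<Longrightarrow> continuous_on {p..q} (phase a x)"
  unfolding phase_def by (intro continuous_intros C1_orbit_continuous_on)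

lemma far_field_eq_integral_cis:
  "far_field p q a x k =
    1 / complex_of_real (sqrt (2 * pi)) * integral {p..q} (\<lambda>t. cis (- (k * phase a x t)))"
  by (simp add: far_field_def phase_def cis_conv_exp mult.assoc)

text \<open>The link between data and distribution: the constant in front of the far-field integral
  is nonzero and cancels.\<close>

lemma equidistributed_phase:
  assumes "p < q" "c < d" "C1_orbit p q a" "C1_orbit p q b"
    and "\<forall>k\<in>{c<..<d}. far_field p q a x k = far_field p q b x k"
  shows "equidistributed p q (phase a x) (phase b x)"
proof
  have *: "continuous_on {p..q} (phase a x)" "continuous_on {p..q} (phase b x)"
    using assms continuous_on_phase by blast+
  then show "continuous_on {p..q} (phase a x)" "continuous_on {p..q} (phase b x)" .
  show "integral {p..q} (\<lambda>t. u (phase a x t)) = integral {p..q} (\<lambda>t. u (phase b x t))"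
    if "continuous_on UNIV u" for u :: "real \<Rightarrow> real"
    by (rule integral_compose_phase_eq[OF * \<open>c < d\<close> _ that])
      (use assms(5) in \<open>auto simp: far_field_eq_integral_cis\<close>)
qed fact

text \<open>The derivative of the phase is \<open>1 + x \<bullet> a'\<close>. Its sign is needed
  only at interior points, where the derivative within the interval is an ordinary one; continuity
  covers the end points.\<close>

lemma mono_on_phase:
  assumes a: "C1_orbit p q a"
    and pos: "\<forall>t\<in>{p..q}. 1 + x \<bullet> vector_derivative a (at t within {p..q}) > 0"
  shows "mono_on {p..q} (phase a x)"
proof (rule mono_onI)
  fix r s assume rs: "r \<in> {p..q}" "s \<in> {p..q}" "r \<le> s"
  show "phase a x r \<le> phase a x s"
  proof (cases "r = s")
    case False
    with rs have "r < s" by simp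
    then have "phase a x r < phase a x s"
    proof (rule DERIV_pos_imp_increasing_open)
      show "continuous_on {r..s} (phase a x)"
        by (rule continuous_on_subset[OF continuous_on_phase[OF a]]) (use rs in auto)
      fix t assume t: "r < t" "t < s"
      then have t': "t \<in> {p..q}" "p < t" "t < q" using rs by auto
      let ?D = "vector_derivative a (at t within {p..q})"
      have "a differentiable (at t within {p..q})"
        using a t' unfolding C1_orbit_def by (metis differentiableI_vector)
      then have "(a has_vector_derivative ?D) (at t within {p..q})"
        by (simp add: vector_derivative_works)
      then have "(a has_vector_derivative ?D) (at t)"
        using at_within_Icc_at[OF t'(2,3)] by simp
      then have "(phase a x has_real_derivative x \<bullet> ?D + 1) (at t)"
        unfolding phase_def has_real_derivative_iff_has_vector_derivative
        by (auto intro!: derivative_eq_intros bounded_linear.has_vector_derivative[OF bounded_linear_inner_right])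
      moreover have "x \<bullet> ?D + 1 > 0" using pos t' by (simp add: add.commute)
      ultimately show "\<exists>y. (phase a x has_real_derivative y) (at t) \<and> 0 < y" by blast
    qed
    then show ?thesis by simp
  qed simp
qed

lemma xi_eq:
  assumes "equidistributed p q (phase a x) (phase b x)"
  shows "xi_min p q a x = xi_min p q b x" "xi_max p q a x = xi_max p q b x"
  using equidistributed.image_eq[OF assms] by (simp_all add: xi_min_def xi_max_def)

lemma strip_K_eq:
  assumes "equidistributed p q (phase a x) (phase b x)"
  shows "strip_K p q a x = strip_K p q b x"
  using xi_eq[OF assms] by (simp add: strip_K_def)

lemma observable_eq:
  assumes "equidistributed p q (phase a x) (phase b x)"
  shows "observable p q a x \<longleftrightarrow> observable p q b x"
  using xi_eq[OF assms] by (simp add: observable_def)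

text \<open>Monotone phases with the same distribution agree pointwise, and subtracting
  \<open>t\<close> leaves equal projections of the two orbits.\<close>

lemma trajectory_strip_eq:
  assumes eqd: "equidistributed p q (phase a x) (phase b x)"
    and "mono_on {p..q} (phase a x)" "mono_on {p..q} (phase b x)"
  shows "trajectory_strip p q a x = trajectory_strip p q b x"
proof -
  have "x \<bullet> a t = x \<bullet> b t" if "t \<in> {p..q}" for t
    using equidistributed.mono_eq[OF eqd assms(2,3) that] by (simp add: phase_def)
  then show ?thesis
    by (auto simp: trajectory_strip_def trajectory_def image_image)
qed

theorem theorem4p3:
  fixes tmin tmax kmin kmax :: real
  assumes dim: "CARD('d::finite) \<in> {2, 3}"
    and t: "0 < tmin" "tmin < tmax"
    and k: "0 < kmin" "kmin < kmax"
  shows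
    "(\<forall>(a :: real \<Rightarrow> real ^ 'd) b.
        C1_orbit tmin tmax a \<longrightarrow> C1_orbit tmin tmax b \<longrightarrow>
        (\<forall>x\<in>sphere 0 1. \<forall>k\<in>{kmin<..<kmax}.
            far_field tmin tmax a x k = far_field tmin tmax b x k) \<longrightarrow>
        Theta_convex_domain tmin tmax a (observable_directions tmin tmax a) =
        Theta_convex_domain tmin tmax b (observable_directions tmin tmax b)) \<and>
     (\<forall>x\<in>sphere (0 :: real ^ 'd) 1. \<forall>a b.
        C1_orbit tmin tmax a \<longrightarrow> C1_orbit tmin tmax b \<longrightarrow>
        observable tmin tmax a x \<longrightarrow> observable tmin tmax b x \<longrightarrow>
        (\<forall>k\<in>{kmin<..<kmax}. far_field tmin tmax a x k = far_field tmin tmax b x k) \<longrightarrow>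
        strip_K tmin tmax a x = strip_K tmin tmax b x \<and>
        ((\<forall>t\<in>{tmin..tmax}. 1 + x \<bullet> vector_derivative a (at t within {tmin..tmax}) > 0) \<longrightarrow>
         (\<forall>t\<in>{tmin..tmax}. 1 + x \<bullet> vector_derivative b (at t within {tmin..tmax}) > 0) \<longrightarrow>
         trajectory_strip tmin tmax a x = trajectory_strip tmin tmax b x))"
proof (intro conjI allI impI ballI)
  fix a b :: "real \<Rightarrow> real ^ 'd"
  assume ab: "C1_orbit tmin tmax a" "C1_orbit tmin tmax b"
    and eq: "\<forall>x\<in>sphere 0 1. \<forall>k\<in>{kmin<..<kmax}.
      far_field tmin tmax a x k = far_field tmin tmax b x k"
  have eqd: "equidistributed tmin tmax (phase a x) (phase b x)" if "x \<in> sphere 0 1" for x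
    using equidistributed_phase[OF t(2) k(2) ab] eq that by blast
  \<comment> \<open>The index sets of the two intersections depend on the orbits, so they have to be
    matched before the strips are compared.\<close>
  have "observable_directions tmin tmax a = observable_directions tmin tmax b"
    using observable_eq[OF eqd] by (auto simp: observable_directions_def)
  moreover have "strip_K tmin tmax a x = strip_K tmin tmax b x"
    if "x \<in> observable_directions tmin tmax b" for x
    using strip_K_eq[OF eqd] that by (simp add: observable_directions_def)
  ultimately show "Theta_convex_domain tmin tmax a (observable_directions tmin tmax a) =
      Theta_convex_domain tmin tmax b (observable_directions tmin tmax b)"
    by (simp add: Theta_convex_domain_def)
next
  fix x :: "real ^ 'd" and a b
  assume ab: "C1_orbit tmin tmax a" "C1_orbit tmin tmax b"
    and eq: "\<forall>k\<in>{kmin<..<kmax}. far_field tmin tmax a x k = far_field tmin tmax b x k"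
  note eqd = equidistributed_phase[OF t(2) k(2) ab eq]
  show "strip_K tmin tmax a x = strip_K tmin tmax b x"
    by (rule strip_K_eq[OF eqd])
  assume "\<forall>t\<in>{tmin..tmax}. 1 + x \<bullet> vector_derivative a (at t within {tmin..tmax}) > 0"
    and "\<forall>t\<in>{tmin..tmax}. 1 + x \<bullet> vector_derivative b (at t within {tmin..tmax}) > 0"
  then show "trajectory_strip tmin tmax a x = trajectory_strip tmin tmax b x"
    by (intro trajectory_strip_eq[OF eqd] mono_on_phase ab)
qed

end
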